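(* Let $\mathbb{G},\mathbb{H}$ be sublattices of $\mathbb{Z}^d$ with $\mathbb{G}\oplus\mathbb{H}=\mathbb{Z}^d$, with bases $\mathbf{B}_{\mathbb{G}}$ and $\mathbf{B}_{\mathbb{H}}$. Let $\mathbf{T}_F\subset\mathcal{A}^{\mathbb{Z}^d}$ and $\mathbf{T}_{F'}\subset\mathcal{A}'^{\mathbb{Z}^d}$ be two subshifts of finite type with finite sets of forbidden patterns $F$ and $F'$. If $\mathbf{T}_F$ and $\mathbf{T}_{F'}$ are conjugate, then there exist $r,r',M\in\mathbb{N}$ such that for all $k\in\mathbb{N}$ $$\varphi_{F,\mathrm{Id},\mathbf{B}_{\mathbb{G}},\mathbf{B}_{\mathbb{H}}}(k)\leq\varphi_{\theta_{r'}(F'),\mathrm{Id},\mathbf{B}_{\mathbb{G}},\mathbf{B}_{\mathbb{H}}}(k+2r)+M\leq\varphi_{\theta_{2r'}(F),\mathrm{Id},\mathbf{B}_{\mathbb{G}},\mathbf{B}_{\mathbb{H}}}(k+4r)+2M.$$ Moreover one can choose $r'=0$ if the neighborhood of the conjugacy is included in $\mathbb{G}$.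
   Context: Intervals $[a,b]$ are integer intervals. A subshift of $\mathcal{A}^{\mathbb{Z}^d}$ ($\mathcal{A}$ a finite alphabet) is a closed shift-invariant subset. A pattern is an element $p\in\mathcal{A}^{\mathbb{U}}$ with $\mathbb{U}\subset\mathbb{Z}^d$ finite; it appears in $x$ if $p=x_{\mathbf{i}+\mathbb{U}}$ for some $\mathbf{i}$. $\mathbf{T}_F$ is the set of configurations in which no pattern of $F$ appears; it is of finite type if $F$ is finite. $\mathcal{L}(X)$ is the set of patterns appearing in elements of $X$. A morphism is a continuous shift-commuting map between subshifts; it is given by a local rule $\psi(x)_{\mathbf{i}}=\overline{\psi}(x_{\mathbf{i}+\mathbb{U}})$ with a finite neighborhood $\mathbb{U}$. Two subshifts are conjugate if there is a bijective morphism (the conjugacy) between them. Let $\mathbf{B}_{\mathbb{G}}=(\mathbf{u}_1,\dots,\mathbf{u}_{d'})$, $\mathbf{B}_{\mathbb{H}}=(\mathbf{v}_1,\dots,\mathbf{v}_{d''})$, and $\mathbb{B}_n=\{k_1\mathbf{v}_1+\dots+k_{d''}\mathbf{v}_{d''}:(k_1,\dots,k_{d''})\in[-n,n]^{d''}\}$. For finite $F$, $\mathbf{T}_F^{n}$ (the $n$-approximation row) is the set of $x\in\mathcal{A}^{\mathbb{G}+\mathbb{B}_n}$ in which no pattern of $F$ appears (only occurrences with support inside $\mathbb{G}+\mathbb{B}_n$ are considered). $\mathbf{SA}_{\mathbf{B}_{\mathbb{G}}}$ restricts a configuration to $\mathbb{G}$, identified with $\mathbb{Z}^{d'}$ by $\mathbf{B}_{\mathbb{G}}$.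 Speed of convergence as SFT: $\varphi_{F,\mathrm{Id},\mathbf{B}_{\mathbb{G}},\mathbf{B}_{\mathbb{H}}}(k)$ is the least integer $n\geq1$ such that every $u\in\mathcal{A}^{[0,k-1]^{d'}}$ with $u\notin\mathcal{L}(\mathbf{SA}_{\mathbf{B}_{\mathbb{G}}}(\mathbf{T}_F))$ satisfies $u\notin\mathcal{L}(\mathbf{SA}_{\mathbf{B}_{\mathbb{G}}}(\mathbf{T}_F^n))$. Speed of convergence with larger row: for $r\in\mathbb{N}$ let $\theta_r(x)=(x_{\mathbf{i}+\mathbb{B}_r})_{\mathbf{i}}$, a configuration over the alphabet $\mathcal{A}^{\mathbb{B}_r}$. $\varphi_{\theta_r(F),\mathrm{Id},\mathbf{B}_{\mathbb{G}},\mathbf{B}_{\mathbb{H}}}(k)$ is the speed of convergence of $\mathbf{T}_F$ for a row of size $r$: the least integer $n\geq\max(1,r)$ such that every $u\in(\mathcal{A}^{\mathbb{B}_r})^{[0,k-1]^{d'}}$ with $u\notin\mathcal{L}(\mathbf{SA}_{\mathbf{B}_{\mathbb{G}}}(\theta_r(\mathbf{T}_F)))$ satisfies $u\notin\mathcal{L}(\mathbf{SA}_{\mathbf{B}_{\mathbb{G}}}(\theta_r(\mathbf{T}_F^n)))$. For $r=0$ this is $\varphi_{F,\mathrm{Id},\mathbf{B}_{\mathbb{G}},\mathbf{B}_{\mathbb{H}}}$.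
   Formalization: In the "Moreover" clause, both the conjugacy and its inverse are required to have a neighborhood included in G; with the condition on the conjugacy alone the claim with r'=0 is false. *)

theory Defs
  imports "HOL-Analysis.Analysis" "HOL-Library.Function_Algebras" "HOL-Library.Set_Algebras"
begin

text \<open>
  An element of \<open>A\<^sup>S\<close> is a partial map with domain \<open>S\<close> and values in \<open>A\<close>, so that configurations,
  rows and patterns are objects of the same kind. Positions are taken in an arbitrary abelian
  group type: \<open>int ^ 'd\<close> for the ambient lattice, and \<open>nat \<Rightarrow> int\<close> (through \<open>int_pow m\<close>) for the
  coordinates with respect to a basis of a sublattice of rank \<open>m\<close>, where \<open>m = 0\<close> is allowed.
\<close>

definition configs :: "'g set \<Rightarrow> 'a set \<Rightarrow> ('g \<rightharpoonup> 'a) set" where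
  "configs S A = {x. dom x = S \<and> ran x \<subseteq> A}"

definition patterns :: "'a set \<Rightarrow> ('g \<rightharpoonup> 'a) set" where
  "patterns A = {p. finite (dom p) \<and> ran p \<subseteq> A}"

definition shift :: "'g::ab_group_add \<Rightarrow> ('g \<rightharpoonup> 'a) \<Rightarrow> ('g \<rightharpoonup> 'a)" where
  "shift i x = (\<lambda>j. x (i + j))"

text \<open>For partial \<open>x\<close>, the occurrence is forced to have its support inside \<open>dom x\<close>.\<close>

definition appears :: "('g::ab_group_add \<rightharpoonup> 'a) \<Rightarrow> ('g \<rightharpoonup> 'a) \<Rightarrow> bool" where
  "appears p x \<longleftrightarrow> (\<exists>i. p \<subseteq>\<^sub>m shift i x)"

definition avoiding :: "'g::ab_group_add set \<Rightarrow> 'a set \<Rightarrow> ('g \<rightharpoonup> 'a) set \<Rightarrow> ('g \<rightharpoonup> 'a) set" where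
  "avoiding S A F = {x \<in> configs S A. \<forall>p\<in>F. \<not> appears p x}"

definition sft :: "'a set \<Rightarrow> ('g::ab_group_add \<rightharpoonup> 'a) set \<Rightarrow> ('g \<rightharpoonup> 'a) set" where
  "sft A F = avoiding UNIV A F"

definition language :: "('g::ab_group_add \<rightharpoonup> 'a) set \<Rightarrow> ('g \<rightharpoonup> 'a) set" where
  "language X = {p. finite (dom p) \<and> (\<exists>x\<in>X. appears p x)}"


text \<open>The prodiscrete topology; on configurations with full support, whose values are all of the
  form \<open>Some a\<close>, it induces the product of the discrete topologies on the alphabet.\<close>

definition config_topology :: "('g \<rightharpoonup> 'a) topology" where
  "config_topology = product_topology (\<lambda>_. discrete_topology UNIV) UNIV"

definition morphism ::
    "(('g::ab_group_add \<rightharpoonup> 'a) \<Rightarrow> ('g \<rightharpoonup> 'b)) \<Rightarrow> ('g \<rightharpoonup> 'a) set \<Rightarrow> ('g \<rightharpoonup> 'b) set \<Rightarrow> bool" where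
  "morphism \<psi> X Y \<longleftrightarrow>
     continuous_map (subtopology config_topology X) (subtopology config_topology Y) \<psi> \<and>
     (\<forall>x\<in>X. \<forall>i. \<psi> (shift i x) = shift i (\<psi> x))"

definition conjugacy ::
    "(('g::ab_group_add \<rightharpoonup> 'a) \<Rightarrow> ('g \<rightharpoonup> 'b)) \<Rightarrow> ('g \<rightharpoonup> 'a) set \<Rightarrow> ('g \<rightharpoonup> 'b) set \<Rightarrow> bool" where
  "conjugacy \<psi> X Y \<longleftrightarrow> morphism \<psi> X Y \<and> bij_betw \<psi> X Y"

definition conjugate :: "('g::ab_group_add \<rightharpoonup> 'a) set \<Rightarrow> ('g \<rightharpoonup> 'b) set \<Rightarrow> bool" where
  "conjugate X Y \<longleftrightarrow> (\<exists>\<psi>. conjugacy \<psi> X Y)"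

definition has_neighborhood ::
    "(('g::ab_group_add \<rightharpoonup> 'a) \<Rightarrow> ('g \<rightharpoonup> 'b)) \<Rightarrow> ('g \<rightharpoonup> 'a) set \<Rightarrow> 'g set \<Rightarrow> bool" where
  "has_neighborhood \<psi> X U \<longleftrightarrow>
     finite U \<and> (\<exists>\<psi>'. \<forall>x\<in>X. \<forall>i. \<psi> x i = Some (\<psi>' (shift i x |` U)))"

text \<open>Both directions are required: a bijective morphism with neighborhood inside a sublattice may
  have an inverse none of whose neighborhoods is inside that sublattice.\<close>

definition conjugacy_within ::
    "'g::ab_group_add set \<Rightarrow> (('g \<rightharpoonup> 'a) \<Rightarrow> ('g \<rightharpoonup> 'b)) \<Rightarrow> ('g \<rightharpoonup> 'a) set \<Rightarrow> ('g \<rightharpoonup> 'b) set \<Rightarrow> bool"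
  where
  "conjugacy_within G \<psi> X Y \<longleftrightarrow> conjugacy \<psi> X Y \<and>
     (\<exists>U\<subseteq>G. has_neighborhood \<psi> X U) \<and>
     (\<exists>V\<subseteq>G. has_neighborhood (inv_into X \<psi>) Y V)"


interpretation int_vec: module "(*s) :: int \<Rightarrow> int ^ 'd::finite \<Rightarrow> int ^ 'd"
  by standard (simp_all add: vector_add_ldistrib vector_sadd_rdistrib)

definition int_pow :: "nat \<Rightarrow> (nat \<Rightarrow> int) set" where
  "int_pow m = {c. \<forall>j\<ge>m. c j = 0}"

text \<open>The cube \<open>[0, k - 1]\<^sup>m\<close>, where \<open>[0, -1]\<close> is empty.\<close>

definition cube :: "nat \<Rightarrow> nat \<Rightarrow> (nat \<Rightarrow> int) set" where
  "cube k m = {c \<in> int_pow m. \<forall>j<m. 0 \<le> c j \<and> c j < int k}"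

definition lincomb :: "(int ^ 'd) list \<Rightarrow> (nat \<Rightarrow> int) \<Rightarrow> int ^ 'd" where
  "lincomb us c = (\<Sum>j<length us. c j *s us ! j)"

definition lattice_basis :: "(int ^ 'd::finite) list \<Rightarrow> (int ^ 'd) set \<Rightarrow> bool" where
  "lattice_basis us G \<longleftrightarrow>
     distinct us \<and> int_vec.independent (set us) \<and> int_vec.span (set us) = G"

definition box :: "(int ^ 'd) list \<Rightarrow> nat \<Rightarrow> (int ^ 'd) set" where
  "box vs n = lincomb vs ` {c \<in> int_pow (length vs). \<forall>j<length vs. \<bar>c j\<bar> \<le> int n}"

definition approx_row ::
    "'a set \<Rightarrow> (int ^ 'd::finite \<rightharpoonup> 'a) set \<Rightarrow> (int ^ 'd) list \<Rightarrow> (int ^ 'd) list \<Rightarrow> nat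
     \<Rightarrow> (int ^ 'd \<rightharpoonup> 'a) set" where
  "approx_row A F us vs n = avoiding (int_vec.span (set us) + box vs n) A F"

text \<open>Restriction to the lattice spanned by \<open>us\<close>, read in coordinates.\<close>

definition SA :: "(int ^ 'd) list \<Rightarrow> (int ^ 'd \<rightharpoonup> 'a) \<Rightarrow> ((nat \<Rightarrow> int) \<rightharpoonup> 'a)" where
  "SA us x = (\<lambda>c. x (lincomb us c)) |` int_pow (length us)"

text \<open>\<open>theta vs r x\<close> is defined exactly at those \<open>i\<close> for which \<open>x\<close> is defined on \<open>i + box vs r\<close>. In
  particular, for \<open>x\<close> in \<open>approx_row A F us vs n\<close> with \<open>n \<ge> r\<close>, it is defined on the lattice
  spanned by \<open>us\<close>.\<close>

definition theta ::
    "(int ^ 'd) list \<Rightarrow> nat \<Rightarrow> (int ^ 'd \<rightharpoonup> 'a) \<Rightarrow> (int ^ 'd \<rightharpoonup> (int ^ 'd \<rightharpoonup> 'a))" where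
  "theta vs r x =
     (\<lambda>i. if \<forall>b\<in>box vs r. i + b \<in> dom x then Some (shift i x |` box vs r) else None)"

text \<open>In the next two definitions the set of admissible \<open>n\<close> is nonempty by compactness when \<open>A\<close> and
  \<open>F\<close> are finite, the patterns in \<open>F\<close> have finite support, and \<open>us\<close>, \<open>vs\<close> are bases of
  complementary sublattices.\<close>

definition speed ::
    "'a set \<Rightarrow> (int ^ 'd::finite \<rightharpoonup> 'a) set \<Rightarrow> (int ^ 'd) list \<Rightarrow> (int ^ 'd) list \<Rightarrow> nat \<Rightarrow> nat"
  where
  "speed A F us vs k = (LEAST n. n \<ge> 1 \<and>
     (\<forall>u \<in> configs (cube k (length us)) A.
        u \<notin> language (SA us ` sft A F) \<longrightarrow> u \<notin> language (SA us ` approx_row A F us vs n)))"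

definition speed_row ::
    "nat \<Rightarrow> 'a set \<Rightarrow> (int ^ 'd::finite \<rightharpoonup> 'a) set \<Rightarrow> (int ^ 'd) list \<Rightarrow> (int ^ 'd) list
     \<Rightarrow> nat \<Rightarrow> nat" where
  "speed_row r A F us vs k = (LEAST n. n \<ge> max 1 r \<and>
     (\<forall>u \<in> configs (cube k (length us)) (configs (box vs r) A).
        u \<notin> language (SA us ` theta vs r ` sft A F) \<longrightarrow>
        u \<notin> language (SA us ` theta vs r ` approx_row A F us vs n)))"

end

theory Submission
  imports Defs
begin

text \<open>
  By compactness, if a configuration avoids \<open>F\<close> on a sufficiently large finite window then its
  restriction to a given smaller window extends to an element of the subshift. Hence the local rule
  of a conjugacy can be applied to the rows avoiding \<open>F\<close>, at the price of thinning them by a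
  constant \<open>M\<close>: the image is a row avoiding \<open>F'\<close>, and the local rule of the inverse recovers the
  original row from it. If the image agrees with an element of \<open>sft A' F'\<close> on a cube enlarged by
  the two neighborhoods (by \<open>r\<close> along the first lattice and \<open>r'\<close> along the second), then the image
  of that element under the inverse conjugacy agrees with the original row on the cube.
\<close>

section \<open>Configurations, shifts and occurrences of patterns\<close>

lemma mem_configs_iff: "x \<in> configs S A \<longleftrightarrow> (\<forall>i. if i \<in> S then x i \<in> Some ` A else x i = None)"
proof
  assume "x \<in> configs S A"
  then show "\<forall>i. if i \<in> S then x i \<in> Some ` A else x i = None"
    by (fastforce simp: configs_def dom_def ran_def)
next
  assume *: "\<forall>i. if i \<in> S then x i \<in> Some ` A else x i = None"
  have "dom x = S" using * by (auto simp: dom_def) (metis imageE option.discI)+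
  moreover have "ran x \<subseteq> A"
  proof
    fix a assume "a \<in> ran x"
    then obtain i where "x i = Some a" by (auto simp: ran_def)
    then show "a \<in> A" using *[rule_format, of i] by (auto split: if_splits)
  qed
  ultimately show "x \<in> configs S A" by (simp add: configs_def)
qed

lemma mem_configs_UNIV_iff: "x \<in> configs UNIV A \<longleftrightarrow> (\<forall>i. x i \<in> Some ` A)"
  by (simp add: mem_configs_iff)

lemma configsD: "x \<in> configs S A \<Longrightarrow> i \<in> S \<Longrightarrow> x i \<in> Some ` A"
  by (simp add: mem_configs_iff)

lemma shift_0 [simp]: "shift 0 x = x"
  by (simp add: shift_def)

lemma shift_shift: "shift i (shift j x) = shift (j + i) x"
  by (simp add: shift_def add.assoc)

lemma appears_iff: "appears p x \<longleftrightarrow> (\<exists>i. \<forall>j\<in>dom p. x (i + j) = p j)"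
  by (metis appears_def map_le_def shift_def)

lemma appears_shift: "appears p (shift i x) \<longleftrightarrow> appears p x"
proof
  assume "appears p (shift i x)"
  then show "appears p x" by (auto simp: appears_def shift_shift)
next
  assume "appears p x"
  then obtain j where "p \<subseteq>\<^sub>m shift j x" by (auto simp: appears_def)
  then have "p \<subseteq>\<^sub>m shift (j - i) (shift i x)" by (simp add: shift_shift)
  then show "appears p (shift i x)" unfolding appears_def by blast
qed

lemma avoiding_shift:
  assumes "x \<in> avoiding S A F" and "\<And>j. i + j \<in> S \<longleftrightarrow> j \<in> T"
  shows "shift i x \<in> avoiding T A F"
  using assms unfolding avoiding_def
  by (auto simp: appears_shift mem_configs_iff) (auto simp: shift_def)

lemma sft_shift: "x \<in> sft A F \<Longrightarrow> shift i x \<in> sft A F"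
  by (auto simp: sft_def intro: avoiding_shift)

lemma sft_subset_configs: "sft A F \<subseteq> configs UNIV A"
  by (auto simp: sft_def avoiding_def)

lemma sftD: "x \<in> sft A F \<Longrightarrow> x i \<in> Some ` A"
  using sft_subset_configs[of A F] by (auto simp: mem_configs_UNIV_iff)

text \<open>Two independent positions \<open>i\<close> and \<open>j\<close> are allowed because
  values of \<psi> are compared between different configurations read around different origins, as
  happens when local images are glued and when an image row is translated.\<close>

lemma has_neighborhoodD:
  assumes "has_neighborhood \<psi> X U" "x \<in> X" "y \<in> X" "\<And>u. u \<in> U \<Longrightarrow> x (i + u) = y (j + u)"
  shows "\<psi> x i = \<psi> y j"
proof -
  obtain \<psi>' where \<psi>': "\<And>x i. x \<in> X \<Longrightarrow> \<psi> x i = Some (\<psi>' (shift i x |` U))"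
    using assms(1) by (auto simp: has_neighborhood_def)
  have "shift i x |` U = shift j y |` U"
    using assms(4) by (auto simp: restrict_map_def shift_def fun_eq_iff)
  then show ?thesis using \<psi>' assms(2,3) by simp
qed

section \<open>Compactness\<close>

lemma topspace_config_topology [simp]: "topspace config_topology = UNIV"
  by (simp add: config_topology_def)

lemma openin_agreement:
  assumes "finite U"
  shows "openin config_topology {w. \<forall>i\<in>U. w i = z i}"
proof -
  have "{w. \<forall>i\<in>U. w i = z i} = PiE UNIV (\<lambda>i. if i \<in> U then {z i} else UNIV)"
    by (auto simp: PiE_def Pi_def split: if_splits)
  moreover have "finite {i. (if i \<in> U then {z i} else UNIV) \<noteq> UNIV}"
    by (rule finite_subset[OF _ assms]) auto
  ultimately show ?thesis
    by (simp add: config_topology_def openin_PiE_gen)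
qed

lemma compactin_configs:
  assumes "finite A"
  shows "compactin config_topology (configs S A)"
proof -
  have "configs S A = PiE UNIV (\<lambda>i. if i \<in> S then Some ` A else {None})"
    by (auto simp: mem_configs_iff PiE_def Pi_def split: if_splits)
  then show ?thesis
    using assms by (simp add: config_topology_def compactin_PiE compactin_discrete_topology)
qed

text \<open>An occurrence at a fixed position is a cylinder condition because the support is finite;
  the union of these cylinders over all positions is open.\<close>

lemma closedin_avoidance:
  assumes "finite (dom p)"
  shows "closedin config_topology {x. \<not> appears p x}"
proof -
  have "openin config_topology (\<Union>i. {x. \<forall>j\<in>(+) i ` dom p. x j = p (j - i)})"
    using assms by (intro openin_Union ballI) (auto simp del: ball_simps intro!: openin_agreement)
  also have "(\<Union>i. {x. \<forall>j\<in>(+) i ` dom p. x j = p (j - i)}) = {x. appears p x}"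
    by (auto simp: appears_iff)
  finally have "openin config_topology {x. appears p x}" .
  moreover have "{x. \<not> appears p x} = topspace config_topology - {x. appears p x}"
    by auto
  ultimately show ?thesis by (metis closedin_diff closedin_topspace)
qed

lemma compactin_sft:
  fixes F :: "('g::ab_group_add \<rightharpoonup> 'a) set"
  assumes "finite A" "F \<subseteq> patterns A"
  shows "compactin config_topology (sft A F)"
proof -
  have "sft A F = configs UNIV A \<inter> (\<Inter>p\<in>F. {x. \<not> appears p x})"
    by (auto simp: sft_def avoiding_def)
  \<comment> \<open>The rule for intersections of closed sets asks for a nonempty family, hence the
    case distinction on \<open>F\<close>.\<close>
  moreover have "closedin config_topology (\<Inter>p\<in>F. {x. \<not> appears p x})" if "F \<noteq> {}"
    using assms(2) that by (intro closedin_Inter) (auto simp: patterns_def intro!: closedin_avoidance)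
  ultimately show ?thesis
    using compactin_configs[OF assms(1), of UNIV]
    by (cases "F = {}") (auto intro: compact_Int_closedin)
qed

text \<open>Each point \<open>z\<close> of \<open>K\<close> lies in its own cylinder of radius
  \<open>U z\<close>; a finite subcover consists of finitely many of these. Compactness enters in
  this form both for local admissibility and for the existence of local rules.\<close>

lemma finite_agreement_cover:
  assumes K: "compactin config_topology K" and U: "\<forall>z\<in>K. finite (U z)"
  shows "\<exists>Z\<subseteq>K. finite Z \<and> (\<forall>w\<in>K. \<exists>z\<in>Z. \<forall>i\<in>U z. w i = z i)"
proof -
  define N where "N z = {w. \<forall>i\<in>U z. w i = z i}" for z
  have "\<exists>\<F>. finite \<F> \<and> \<F> \<subseteq> N ` K \<and> K \<subseteq> \<Union>\<F>"
    using K unfolding compactin_def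
    by (elim conjE allE[where x = "N ` K"]) (auto simp: N_def intro!: openin_agreement bspec[OF U])
  then obtain \<F> where "finite \<F>" "\<F> \<subseteq> N ` K" "K \<subseteq> \<Union>\<F>" by blast
  then obtain Z where "Z \<subseteq> K" "finite Z" "\<F> = N ` Z"
    by (meson finite_subset_image)
  moreover have "\<exists>z\<in>Z. w \<in> N z" if "w \<in> K" for w
    using that \<open>K \<subseteq> \<Union>\<F>\<close> \<open>\<F> = N ` Z\<close> by blast
  ultimately show ?thesis by (intro exI[of _ Z]) (simp add: N_def)
qed

text \<open>Compactness is applied in the full shift. A configuration \<open>z\<close> that agrees
  on \<open>S\<close> with an element of the subshift gets the window \<open>S\<close>; any other
  \<open>z\<close> contains a forbidden pattern, and the support of one occurrence is its window.
  \<open>W\<close> collects the windows of a finite subcover. It does not depend on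
  \<open>D\<close>, so it serves for infinite rows as well.\<close>

lemma locally_admissible_extends:
  fixes F :: "('g::ab_group_add \<rightharpoonup> 'a) set"
  assumes A: "finite A" and F: "F \<subseteq> patterns A" and S: "finite S"
  obtains W where "finite W"
    and "\<And>D x. W \<subseteq> D \<Longrightarrow> x \<in> avoiding D A F \<Longrightarrow> \<exists>z\<in>sft A F. \<forall>s\<in>S. z s = x s"
proof -
  define ext :: "('g \<rightharpoonup> 'a) \<Rightarrow> bool" where "ext z \<longleftrightarrow> (\<exists>y\<in>sft A F. \<forall>s\<in>S. y s = z s)" for z
  have ex: "\<forall>z\<in>configs UNIV A. \<exists>U. finite U \<and> (if ext z then U = S else
      \<exists>p\<in>F. \<exists>i. U = (+) i ` dom p \<and> (\<forall>j\<in>dom p. z (i + j) = p j))"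
    (is "\<forall>z\<in>_. ?R z")
  proof
    fix z :: "'g \<rightharpoonup> 'a" assume "z \<in> configs UNIV A"
    show "?R z"
    proof (cases "ext z")
      case False
      then have "z \<notin> sft A F" by (auto simp: ext_def)
      then obtain p where p: "p \<in> F" "appears p z"
        using \<open>z \<in> configs UNIV A\<close> by (auto simp: sft_def avoiding_def)
      then obtain i where "\<forall>j\<in>dom p. z (i + j) = p j" by (auto simp: appears_iff)
      moreover have "finite ((+) i ` dom p)" using p F by (auto simp: patterns_def)
      ultimately have "finite ((+) i ` dom p) \<and> (\<exists>q\<in>F. \<exists>k.
          (+) i ` dom p = (+) k ` dom q \<and> (\<forall>j\<in>dom q. z (k + j) = q j))"
        using p(1) by blast
      then show ?thesis using False by (intro exI[of _ "(+) i ` dom p"]) simp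
    qed (use S in simp)
  qed
  obtain U where "\<forall>z\<in>configs UNIV A. finite (U z) \<and> (if ext z then U z = S else
      \<exists>p\<in>F. \<exists>i. U z = (+) i ` dom p \<and> (\<forall>j\<in>dom p. z (i + j) = p j))"
    using bchoice[OF ex] by (elim exE)
  then have U: "\<forall>z\<in>configs UNIV A. finite (U z)"
    "\<And>z. z \<in> configs UNIV A \<Longrightarrow> ext z \<Longrightarrow> U z = S"
    "\<And>z. z \<in> configs UNIV A \<Longrightarrow> \<not> ext z \<Longrightarrow>
      \<exists>p\<in>F. \<exists>i. U z = (+) i ` dom p \<and> (\<forall>j\<in>dom p. z (i + j) = p j)"
    by presburger+
  obtain Z where Z: "Z \<subseteq> configs UNIV A" "finite Z"
    "\<forall>w\<in>configs UNIV A. \<exists>z\<in>Z. \<forall>i\<in>U z. w i = z i"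
    using finite_agreement_cover[OF compactin_configs[OF A] U(1)]
    by (elim exE conjE)
  text \<open>The point \<open>0\<close> is only there to exclude the empty alphabet.\<close>
  define W where "W = insert 0 (S \<union> (\<Union>z\<in>Z. U z))"
  show thesis
  proof (rule that)
    show "finite W" using S Z U(1) by (auto simp: W_def)
  next
    fix D x assume "W \<subseteq> D" and x: "x \<in> avoiding D A F"
    then have xc: "x \<in> configs D A" by (auto simp: avoiding_def)
    have "x 0 \<in> Some ` A" using configsD[OF xc, of 0] \<open>W \<subseteq> D\<close> by (auto simp: W_def)
    then obtain a where a: "a \<in> A" by auto
    \<comment> \<open>The configuration is padded by a constant letter to reach the compact space.
      Forbidden patterns created by the padding do no harm, since only windows inside
      \<open>W\<close>, hence inside \<open>D\<close>, are examined.\<close>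
    define w where "w i = (if i \<in> D then x i else Some a)" for i
    have w: "w \<in> configs UNIV A"
      using xc a by (auto simp: mem_configs_UNIV_iff w_def dest: configsD)
    have wx: "w i = x i" if "i \<in> W" for i using that \<open>W \<subseteq> D\<close> by (auto simp: w_def)
    obtain z where z: "z \<in> Z" "\<And>i. i \<in> U z \<Longrightarrow> w i = z i" using bspec[OF Z(3) w] by (elim bexE) simp
    then have zc: "z \<in> configs UNIV A" using Z by blast
    have UW: "U z \<subseteq> W" using z by (auto simp: W_def)
    \<comment> \<open>A centre of the other kind would show a forbidden pattern on
      \<open>U z\<close>, where \<open>z\<close>, \<open>w\<close> and \<open>x\<close>
      coincide.\<close>
    have "ext z"
    proof (rule ccontr)
      assume "\<not> ext z"
      then obtain p i where "p \<in> F" and p: "U z = (+) i ` dom p" "\<forall>j\<in>dom p. z (i + j) = p j"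
        using U(3)[OF zc] by blast
      then have "x (i + j) = p j" if "j \<in> dom p" for j
        using z(2)[of "i + j"] wx[of "i + j"] UW that by force
      then have "appears p x" by (auto simp: appears_iff)
      then show False using x \<open>p \<in> F\<close> by (auto simp: avoiding_def)
    qed
    then obtain y where "y \<in> sft A F" "\<forall>s\<in>S. y s = z s" by (auto simp: ext_def)
    moreover have "z s = x s" if "s \<in> S" for s
      using U(2)[OF zc \<open>ext z\<close>] z(2)[of s] wx[of s] that by (auto simp: W_def)
    ultimately show "\<exists>z\<in>sft A F. \<forall>s\<in>S. z s = x s" by auto
  qed
qed

section \<open>Local rules\<close>

text \<open>The Curtis-Hedlund-Lyndon theorem on a subshift of finite type. Continuity gives each
  \<open>x\<close> a finite window that determines the value of \<psi> at \<open>0\<close>,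
  compactness makes the window uniform, and equivariance carries the rule to all positions.\<close>

lemma morphism_has_neighborhood:
  fixes F :: "('g::ab_group_add \<rightharpoonup> 'a) set" and F' :: "('g \<rightharpoonup> 'b) set"
  assumes A: "finite A" and F: "F \<subseteq> patterns A" and m: "morphism \<psi> (sft A F) (sft A' F')"
  shows "\<exists>U. has_neighborhood \<psi> (sft A F) U"
proof -
  let ?X = "sft A F"
  have cont: "continuous_map (subtopology config_topology ?X)
      (subtopology config_topology (sft A' F')) \<psi>"
    and eqv: "\<And>x i. x \<in> ?X \<Longrightarrow> \<psi> (shift i x) = shift i (\<psi> x)"
    using m by (auto simp: morphism_def)
  have maps: "\<psi> x \<in> sft A' F'" if "x \<in> ?X" for x
    using continuous_map_image_subset_topspace[OF cont] that by auto
  have ex: "\<forall>x\<in>?X. \<exists>U. finite U \<and> (\<forall>y\<in>?X. (\<forall>i\<in>U. y i = x i) \<longrightarrow> \<psi> y 0 = \<psi> x 0)"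
  proof
    fix x assume x: "x \<in> ?X"
    have "openin (subtopology config_topology (sft A' F'))
        (sft A' F' \<inter> {y. \<forall>i\<in>{0}. y i = \<psi> x i})"
      by (intro openin_subtopology_Int2 openin_agreement) simp
    from openin_continuous_map_preimage[OF cont this]
    obtain T where T: "openin config_topology T"
      "{y \<in> ?X. \<psi> y \<in> sft A' F' \<and> \<psi> y 0 = \<psi> x 0} = T \<inter> ?X"
      by (auto simp: openin_subtopology)
    then have "x \<in> T" using x maps by blast
    then obtain V where V: "finite {i. V i \<noteq> UNIV}" "x \<in> PiE UNIV V" "PiE UNIV V \<subseteq> T"
      using T(1) unfolding config_topology_def openin_product_topology_alt by auto
    \<comment> \<open>A basic open set of the product constrains only finitely many coordinates;
      these form the window of \<open>x\<close>.\<close>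
    have "y \<in> T" if "\<forall>i\<in>{i. V i \<noteq> UNIV}. y i = x i" for y
    proof -
      have "y i \<in> V i" for i using that V(2) by (cases "V i = UNIV") (auto simp: PiE_def Pi_def)
      then show ?thesis using V(3) by (auto simp: PiE_def Pi_def)
    qed
    then show "\<exists>U. finite U \<and> (\<forall>y\<in>?X. (\<forall>i\<in>U. y i = x i) \<longrightarrow> \<psi> y 0 = \<psi> x 0)"
      using V(1) T(2) by blast
  qed
  obtain U where "\<forall>x\<in>?X. finite (U x) \<and>
      (\<forall>y\<in>?X. (\<forall>i\<in>U x. y i = x i) \<longrightarrow> \<psi> y 0 = \<psi> x 0)"
    using bchoice[OF ex] by (elim exE)
  then have U: "\<forall>x\<in>?X. finite (U x)"
    "\<And>x y. x \<in> ?X \<Longrightarrow> y \<in> ?X \<Longrightarrow> \<forall>i\<in>U x. y i = x i \<Longrightarrow> \<psi> y 0 = \<psi> x 0"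
    by blast+
  obtain Z where Z: "Z \<subseteq> ?X" "finite Z" "\<forall>w\<in>?X. \<exists>z\<in>Z. \<forall>i\<in>U z. w i = z i"
    using finite_agreement_cover[OF compactin_sft[OF A F] U(1)]
    by (elim exE conjE)
  define V where "V = (\<Union>z\<in>Z. U z)"
  have loc: "\<psi> x 0 = \<psi> y 0" if xy: "x \<in> ?X" "y \<in> ?X" "x |` V = y |` V" for x y
  proof -
    obtain z where z: "z \<in> Z" "\<forall>i\<in>U z. x i = z i" using bspec[OF Z(3) xy(1)] by (elim bexE)
    have "x i = y i" if "i \<in> V" for i
      using fun_cong[OF xy(3), of i] that by simp
    then have "\<forall>i\<in>U z. y i = z i" using z by (metis UN_I V_def)
    then show ?thesis using U(2) z Z(1) xy(1,2) by (metis subsetD)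
  qed
  \<comment> \<open>The rule evaluates \<psi> on any element of the subshift showing the pattern
    \<open>p\<close>; by \<open>loc\<close> the choice is immaterial. On patterns that no element
    shows, the value is arbitrary.\<close>
  define \<psi>' where "\<psi>' p = the (\<psi> (SOME x. x \<in> ?X \<and> x |` V = p) 0)" for p
  have "\<psi> x i = Some (\<psi>' (shift i x |` V))" if x: "x \<in> ?X" for x i
  proof -
    let ?y = "SOME y. y \<in> ?X \<and> y |` V = shift i x |` V"
    have "?y \<in> ?X \<and> ?y |` V = shift i x |` V"
      by (rule someI[of _ "shift i x"]) (simp add: sft_shift x)
    then have "\<psi> ?y 0 = \<psi> (shift i x) 0" using loc sft_shift[OF x] by blast
    moreover have "\<psi> (shift i x) 0 = \<psi> x i" using eqv[OF x] by (simp add: shift_def)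
    moreover have "\<psi> x i \<noteq> None" using sftD[OF maps[OF x], of i] by auto
    ultimately show ?thesis by (auto simp: \<psi>'_def)
  qed
  then show ?thesis
    using U(1) Z by (intro exI[of _ V]) (auto simp: has_neighborhood_def V_def)
qed

text \<open>A continuous bijection from a compact space onto a Hausdorff space is a homeomorphism,
  and the inverse of an equivariant bijection is equivariant.\<close>

lemma conjugacy_inverse:
  fixes F :: "('g::ab_group_add \<rightharpoonup> 'a) set" and F' :: "('g \<rightharpoonup> 'b) set"
  assumes A: "finite A" and F: "F \<subseteq> patterns A" and c: "conjugacy \<psi> (sft A F) (sft A' F')"
  shows "morphism (inv_into (sft A F) \<psi>) (sft A' F') (sft A F)"
proof -
  let ?X = "sft A F" and ?Y = "sft A' F'"
  let ?tX = "subtopology config_topology ?X" and ?tY = "subtopology config_topology ?Y"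
  have cont: "continuous_map ?tX ?tY \<psi>"
    and eqv: "\<And>x i. x \<in> ?X \<Longrightarrow> \<psi> (shift i x) = shift i (\<psi> x)"
    and bij: "bij_betw \<psi> ?X ?Y"
    using c by (auto simp: conjugacy_def morphism_def)
  have "compact_space ?tX"
    using compactin_sft[OF A F] by (simp add: compact_space_subtopology)
  moreover have "Hausdorff_space ?tY"
    by (simp add: Hausdorff_space_subtopology config_topology_def Hausdorff_space_product_topology)
  ultimately have "homeomorphic_map ?tX ?tY \<psi>"
    using cont bij by (intro continuous_imp_homeomorphic_map) (auto simp: bij_betw_def)
  then obtain g where g: "homeomorphic_maps ?tX ?tY \<psi> g" by (auto simp: homeomorphic_map_maps)
  \<comment> \<open>The topological inverse \<open>g\<close> is only some map; continuity passes to
    \<open>inv_into\<close> because both agree on the target subshift.\<close>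
  have "continuous_map ?tY ?tX (inv_into ?X \<psi>)"
  proof (rule continuous_map_eq)
    show "continuous_map ?tY ?tX g" using g by (simp add: homeomorphic_maps_def)
    fix y assume "y \<in> topspace ?tY"
    then have y: "y \<in> ?Y" by simp
    then have "g y \<in> ?X" "\<psi> (g y) = y"
      using g continuous_map_image_subset_topspace[of ?tY ?tX g] by (auto simp: homeomorphic_maps_def)
    then show "g y = inv_into ?X \<psi> y"
      using bij by (metis bij_betw_def inv_into_f_f)
  qed
  moreover have "inv_into ?X \<psi> (shift i y) = shift i (inv_into ?X \<psi> y)" if "y \<in> ?Y" for y i
  proof -
    have x: "inv_into ?X \<psi> y \<in> ?X" "\<psi> (inv_into ?X \<psi> y) = y"
      using that bij by (auto simp: bij_betw_def f_inv_into_f inv_into_into)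
    then have "\<psi> (shift i (inv_into ?X \<psi> y)) = shift i y" using eqv by simp
    then show ?thesis
      using bij sft_shift[OF x(1), of i] by (metis bij_betw_def inv_into_f_f)
  qed
  ultimately show ?thesis by (simp add: morphism_def)
qed

text \<open>Away from the boundary of \<open>D\<close>, a configuration avoiding \<open>F\<close> looks locally like an element of
  the subshift, so the local rules of a conjugacy and of its inverse still cancel there.\<close>

lemma local_rule_transfer:
  fixes F :: "('g::ab_group_add \<rightharpoonup> 'a) set" and F' :: "('g \<rightharpoonup> 'b) set"
  assumes A: "finite A" and F: "F \<subseteq> patterns A"
    and F': "finite F'" "F' \<subseteq> patterns A'"
    and \<psi>: "\<psi> \<in> sft A F \<rightarrow> sft A' F'"
    and inv: "\<forall>x\<in>sft A F. \<phi> (\<psi> x) = x"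
    and U: "has_neighborhood \<psi> (sft A F) U" and V: "has_neighborhood \<phi> (sft A' F') V"
  obtains W where "finite W"
    and "\<And>D D' x. D' \<noteq> {} \<Longrightarrow> (\<And>i w. i \<in> D' \<Longrightarrow> w \<in> W \<Longrightarrow> i + w \<in> D) \<Longrightarrow> x \<in> avoiding D A F \<Longrightarrow>
      \<exists>y\<in>avoiding D' A' F'. \<forall>y'\<in>sft A' F'. \<forall>i\<in>D'. \<forall>j.
        (\<forall>v\<in>V. i + v \<in> D' \<and> y' (j + v) = y (i + v)) \<longrightarrow> \<phi> y' j = x i"
proof -
  have maps: "\<psi> x \<in> sft A' F'" if "x \<in> sft A F" for x
    using funcset_mem[OF \<psi> that] .
  \<comment> \<open>\<open>T\<close> holds every offset at which the image is inspected: the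
    supports of \<open>F'\<close>, the neighborhood \<open>V\<close> and the origin.
    \<open>S\<close> is large enough for the values of \<psi> at all differences of such offsets to
    be read off from agreement on \<open>S\<close>.\<close>
  define T where "T = insert 0 (V \<union> (\<Union>p\<in>F'. dom p))"
  define S where "S = insert 0 ((\<lambda>(t, t', u). t - t' + u) ` (T \<times> T \<times> U))"
  have "finite T" using F' V by (auto simp: T_def patterns_def has_neighborhood_def)
  then have "finite S" using U by (auto simp: S_def has_neighborhood_def)
  have SI: "t - t' + u \<in> S" if "t \<in> T" "t' \<in> T" "u \<in> U" for t t' u
    using that by (force simp: S_def)
  have US: "u \<in> S" if "u \<in> U" for u
    using SI[of 0 0 u] that by (simp add: T_def)
  obtain W where W: "finite W"
    "\<And>D x. W \<subseteq> D \<Longrightarrow> x \<in> avoiding D A F \<Longrightarrow> \<exists>z\<in>sft A F. \<forall>s\<in>S. z s = x s"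
    using locally_admissible_extends[OF A F \<open>finite S\<close>] by metis
  show thesis
  proof (rule that[OF W(1)])
    fix D D' x
    assume "D' \<noteq> {}" and D': "\<And>i w. i \<in> D' \<Longrightarrow> w \<in> W \<Longrightarrow> i + w \<in> D"
      and x: "x \<in> avoiding D A F"
    have "\<exists>z\<in>sft A F. \<forall>s\<in>S. z s = x (b + s)" if "b \<in> D'" for b
    proof -
      have "shift b x \<in> avoiding {j. b + j \<in> D} A F"
        by (rule avoiding_shift[OF x]) simp
      from W(2)[OF _ this] show ?thesis using D' that by (auto simp: shift_def)
    qed
    then obtain z where z: "\<And>b. b \<in> D' \<Longrightarrow> z b \<in> sft A F"
      "\<And>b s. b \<in> D' \<Longrightarrow> s \<in> S \<Longrightarrow> z b s = x (b + s)"
      by metis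
    \<comment> \<open>Each value of \<open>y\<close> comes from its own local extension
      \<open>z b\<close>. The next fact shows that the pieces fit: near \<open>b\<close>, all values
      of \<open>y\<close> are those of the single image \<open>\<psi> (z b)\<close>.\<close>
    define y where "y = (\<lambda>b. \<psi> (z b) 0) |` D'"
    have yz: "y (b + (t - e)) = \<psi> (z b) (t - e)"
      if "b \<in> D'" "b + (t - e) \<in> D'" "t \<in> T" "e \<in> T" for b t e
    proof -
      have "\<psi> (z (b + (t - e))) 0 = \<psi> (z b) (t - e)"
        using that by (intro has_neighborhoodD[OF U]) (auto simp: z US SI add.assoc)
      then show ?thesis using that by (simp add: y_def)
    qed
    have "y \<in> configs D' A'"
      using sftD[OF maps[OF z(1)]] by (auto simp: mem_configs_iff y_def restrict_map_def)
    moreover have "\<not> appears p y" if p: "p \<in> F'" for p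
    proof
      assume "appears p y"
      then obtain i where i: "\<And>j. j \<in> dom p \<Longrightarrow> y (i + j) = p j" by (auto simp: appears_iff)
      have iD: "i + j \<in> D'" if "j \<in> dom p" for j
        using i[OF that] that by (auto simp: y_def restrict_map_def split: if_splits)
      \<comment> \<open>An occurrence in the glued \<open>y\<close> is seen inside one genuine
        image, centred at a point \<open>i + e\<close> of the occurrence. A pattern with empty
        support has no such point; it occurs in any image, and \<open>D'\<close> being nonempty
        provides one.\<close>
      have "\<exists>b\<in>D'. appears p (\<psi> (z b))"
      proof (cases "dom p = {}")
        case True
        then show ?thesis using \<open>D' \<noteq> {}\<close> by (auto simp: appears_iff)
      next
        case False
        then obtain e where e: "e \<in> dom p" by blast
        have "\<psi> (z (i + e)) (- e + t) = p t" if "t \<in> dom p" for t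
        proof -
          have "t \<in> T" "e \<in> T" using that e p by (auto simp: T_def)
          then show ?thesis
            using yz[of "i + e" t e] iD[OF e] iD[OF that] i[OF that] by (simp add: algebra_simps)
        qed
        then have "appears p (\<psi> (z (i + e)))" unfolding appears_iff by blast
        then show ?thesis using iD[OF e] by blast
      qed
      then show False using maps[OF z(1)] p by (auto simp: sft_def avoiding_def)
    qed
    moreover have "\<phi> y' j = x i"
      if "y' \<in> sft A' F'" "i \<in> D'" "\<forall>v\<in>V. i + v \<in> D' \<and> y' (j + v) = y (i + v)" for y' i j
    proof -
      \<comment> \<open>Around \<open>j\<close>, the configuration \<open>y'\<close> looks to the
        rule of \<phi> like \<open>\<psi> (z i)\<close> around \<open>0\<close>, so \<phi> returns
        the central letter of \<open>z i\<close>, which is \<open>x i\<close>.\<close>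
      have "y' (j + v) = \<psi> (z i) (0 + v)" if "v \<in> V" for v
        using yz[of i v 0] \<open>i \<in> D'\<close> that \<open>\<forall>v\<in>V. _ v\<close> by (auto simp: T_def)
      then have "\<phi> y' j = \<phi> (\<psi> (z i)) 0"
        using that maps z(1) by (intro has_neighborhoodD[OF V]) auto
      also have "\<dots> = x i" using inv z(1) z(2)[of i 0] that(2) by (simp add: S_def)
      finally show ?thesis .
    qed
    ultimately show "\<exists>y\<in>avoiding D' A' F'. \<forall>y'\<in>sft A' F'. \<forall>i\<in>D'. \<forall>j.
        (\<forall>v\<in>V. i + v \<in> D' \<and> y' (j + v) = y (i + v)) \<longrightarrow> \<phi> y' j = x i"
      by (intro bexI[of _ y]) (auto simp: avoiding_def)
  qed
qed

section \<open>Coordinates\<close>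

lemma lincomb_add: "lincomb us (c + c') = lincomb us c + lincomb us c'"
  by (simp add: lincomb_def vector_sadd_rdistrib sum.distrib)

lemma lincomb_cong: "(\<And>j. j < length us \<Longrightarrow> c j = c' j) \<Longrightarrow> lincomb us c = lincomb us c'"
  by (simp add: lincomb_def)

lemma lincomb_truncate:
  "(\<lambda>j. if j < length us then c j else 0) \<in> int_pow (length us)"
  "lincomb us (\<lambda>j. if j < length us then c j else 0) = lincomb us c"
  by (auto simp: int_pow_def intro: lincomb_cong)

lemma lincomb_in_span: "lincomb us c \<in> int_vec.span (set us)"
  unfolding lincomb_def by (intro int_vec.span_sum int_vec.span_scale int_vec.span_base) simp

lemma spanE:
  assumes "g \<in> int_vec.span (set us)"
  obtains c where "c \<in> int_pow (length us)" "g = lincomb us c"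
proof -
  have "\<exists>c. g = lincomb us c"
    using assms
  proof (induction rule: int_vec.span_induct_alt)
    case base
    have "lincomb us (\<lambda>_. 0) = 0" by (simp add: lincomb_def)
    then show ?case by metis
  next
    case (step k x y)
    then obtain i c where i: "i < length us" "us ! i = x" and "y = lincomb us c"
      by (auto simp: in_set_conv_nth)
    moreover have "lincomb us (\<lambda>j. if j = i then k else 0) = k *s x"
    proof -
      have "lincomb us (\<lambda>j. if j = i then k else 0)
          = (\<Sum>j<length us. if j = i then k *s us ! j else 0)"
        unfolding lincomb_def by (intro sum.cong) auto
      then show ?thesis using i by simp
    qed
    ultimately show ?case by (metis lincomb_add)
  qed
  then show thesis using that lincomb_truncate by metis
qed

section \<open>Boxes and cubes in lattice coordinates\<close>

lemma mem_boxI: "(\<And>j. j < length us \<Longrightarrow> \<bar>c j\<bar> \<le> int n) \<Longrightarrow> lincomb us c \<in> box us n"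
  unfolding box_def by (rule image_eqI[where f = "lincomb us", OF lincomb_truncate(2)[symmetric]])
    (simp add: lincomb_truncate(1))

lemma mem_boxE:
  assumes "g \<in> box us n"
  obtains c where "g = lincomb us c" "\<forall>j<length us. \<bar>c j\<bar> \<le> int n"
  using assms unfolding box_def by blast

lemma box_subset_span: "box us n \<subseteq> int_vec.span (set us)"
  using lincomb_in_span by (auto simp: box_def)

lemma zero_mem_box: "0 \<in> box us n"
proof -
  have "lincomb us (\<lambda>_. 0) \<in> box us n" by (rule mem_boxI) simp
  then show ?thesis by (simp add: lincomb_def)
qed

lemma box_0: "box us 0 = {0}"
proof -
  have "g = 0" if "g \<in> box us 0" for g
  proof -
    obtain c where "g = lincomb us c" "\<forall>j<length us. \<bar>c j\<bar> \<le> int 0"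
      using \<open>g \<in> box us 0\<close> by (rule mem_boxE)
    then show ?thesis by (simp add: lincomb_def)
  qed
  then show ?thesis using zero_mem_box by blast
qed

lemma box_mono: "n \<le> m \<Longrightarrow> box us n \<subseteq> box us m"
  by (force simp: box_def)

lemma box_add:
  assumes "g \<in> box us n" "h \<in> box us m"
  shows "g + h \<in> box us (n + m)"
proof -
  obtain c where c: "g = lincomb us c" "\<forall>j<length us. \<bar>c j\<bar> \<le> int n"
    using assms(1) by (rule mem_boxE)
  obtain e where e: "h = lincomb us e" "\<forall>j<length us. \<bar>e j\<bar> \<le> int m"
    using assms(2) by (rule mem_boxE)
  have "\<bar>(c + e) j\<bar> \<le> int (n + m)" if "j < length us" for j
    using c(2) e(2) that by (fastforce intro: order_trans[OF abs_triangle_ineq])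
  then have "lincomb us (c + e) \<in> box us (n + m)" by (rule mem_boxI)
  then show ?thesis by (simp add: c(1) e(1) lincomb_add)
qed

lemma finite_box: "finite (box us n)"
proof -
  have "finite {c. \<forall>j. (j \<in> {..<length us} \<longrightarrow> c j \<in> {- int n..int n})
      \<and> (j \<notin> {..<length us} \<longrightarrow> c j = 0)}"
    by (intro finite_set_of_finite_funs) simp_all
  then have "finite {c \<in> int_pow (length us). \<forall>j<length us. \<bar>c j\<bar> \<le> int n}"
    by (rule finite_subset[rotated]) (auto simp: int_pow_def abs_le_iff)
  then show ?thesis by (simp add: box_def)
qed

lemma span_mem_box:
  assumes "g \<in> int_vec.span (set us)"
  obtains n where "g \<in> box us n"
proof -
  obtain c where c: "g = lincomb us c" using assms by (rule spanE)
  define n where "n = (\<Sum>j<length us. nat \<bar>c j\<bar>)"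
  have "\<bar>c j\<bar> \<le> int n" if "j < length us" for j
  proof -
    have "nat \<bar>c j\<bar> \<le> n" unfolding n_def using that by (intro member_le_sum) auto
    then show ?thesis by linarith
  qed
  then show thesis using that mem_boxI c by metis
qed

lemma finite_subset_box:
  assumes "finite W" "W \<subseteq> int_vec.span (set us)"
  obtains n where "W \<subseteq> box us n"
proof -
  have "\<exists>n. W \<subseteq> box us n"
    using assms
  proof (induction rule: finite_induct)
    case (insert g W)
    then obtain n where "W \<subseteq> box us n" by blast
    moreover obtain m where "g \<in> box us m" using insert.prems span_mem_box by auto
    ultimately have "insert g W \<subseteq> box us (max n m)"
      using box_mono[of n "max n m" us] box_mono[of m "max n m" us] by auto
    then show ?case ..
  qed simp
  then show thesis using that by blast
qed

text \<open>Every element of \<open>W\<close> splits into a component in each lattice; finitely many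
  components of either kind fit into a box, and the larger radius serves both.\<close>

lemma finite_subset_box_sum:
  assumes "finite W" "int_vec.span (set us) + int_vec.span (set vs) = UNIV"
  obtains n where "W \<subseteq> box us n + box vs n"
proof -
  have "\<exists>g h. w = g + h \<and> g \<in> int_vec.span (set us) \<and> h \<in> int_vec.span (set vs)" for w
    using assms(2) UNIV_I[of w] by (metis set_plus_elim)
  then obtain g h where gh: "\<And>w. w = g w + h w" "\<And>w. g w \<in> int_vec.span (set us)"
    "\<And>w. h w \<in> int_vec.span (set vs)" by metis
  obtain n where n: "g ` W \<subseteq> box us n"
    using finite_subset_box[of "g ` W" us] assms(1) gh(2) by auto
  obtain m where m: "h ` W \<subseteq> box vs m"
    using finite_subset_box[of "h ` W" vs] assms(1) gh(3) by auto
  have "W \<subseteq> box us (max n m) + box vs (max n m)"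
  proof
    fix w assume "w \<in> W"
    then have "g w \<in> box us (max n m)" "h w \<in> box vs (max n m)"
      using n m box_mono[of n "max n m" us] box_mono[of m "max n m" vs] by auto
    then show "w \<in> box us (max n m) + box vs (max n m)"
      using gh(1)[of w] by (metis set_plus_intro)
  qed
  then show thesis by (rule that)
qed

lemma finite_cube: "finite (cube k m)"
proof -
  have "finite {c. \<forall>j. (j \<in> {..<m} \<longrightarrow> c j \<in> {0..int k}) \<and> (j \<notin> {..<m} \<longrightarrow> c j = 0)}"
    by (intro finite_set_of_finite_funs) simp_all
  then show ?thesis
    by (rule finite_subset[rotated]) (auto simp: cube_def int_pow_def less_imp_le)
qed

lemma cube_subset_int_pow: "cube k m \<subseteq> int_pow m"
  by (auto simp: cube_def)

text \<open>The cube starts at \<open>0\<close> while the box is symmetric, so their sum is the cube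
  of side \<open>k + 2 * r\<close> translated by \<open>-r\<close> in every coordinate. Adding
  \<open>r\<close> in every coordinate undoes this translation; this is the source of the term
  \<open>k + 2 * r\<close> in the bounds.\<close>

lemma cube_add_box:
  assumes "c \<in> cube k (length us)" "g \<in> box us r"
  obtains c' where "c' \<in> cube (k + 2 * r) (length us)"
    "lincomb us c' = lincomb us c + lincomb us (\<lambda>_. int r) + g"
proof -
  obtain e where e: "g = lincomb us e" "\<forall>j<length us. \<bar>e j\<bar> \<le> int r"
    using assms(2) by (rule mem_boxE)
  define c' where "c' = (\<lambda>j. if j < length us then (c + (\<lambda>_. int r) + e) j else 0)"
  have "0 \<le> c' j \<and> c' j < int (k + 2 * r)" if "j < length us" for j
    using assms(1) e(2)[rule_format, OF that] that by (auto simp: cube_def c'_def)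
  then have "c' \<in> cube (k + 2 * r) (length us)"
    by (auto simp: cube_def int_pow_def) (simp add: c'_def)
  moreover have "lincomb us c' = lincomb us c + lincomb us (\<lambda>_. int r) + g"
    unfolding c'_def lincomb_truncate(2) lincomb_add e(1) ..
  ultimately show thesis by (rule that)
qed

lemma approx_row_shift:
  assumes "x \<in> approx_row A F us vs n" "g \<in> int_vec.span (set us)"
  shows "shift g x \<in> approx_row A F us vs n"
proof -
  have "g + j \<in> int_vec.span (set us) + B \<longleftrightarrow> j \<in> int_vec.span (set us) + B" for j B
  proof
    assume "g + j \<in> int_vec.span (set us) + B"
    then obtain h b where "h \<in> int_vec.span (set us)" "b \<in> B" "g + j = h + b"
      by (auto elim: set_plus_elim)
    then have "h - g \<in> int_vec.span (set us)" "b \<in> B" "j = (h - g) + b"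
      using assms(2) by (auto simp: int_vec.span_diff algebra_simps)
    then show "j \<in> int_vec.span (set us) + B" by (metis set_plus_intro)
  next
    assume "j \<in> int_vec.span (set us) + B"
    then obtain h b where "h \<in> int_vec.span (set us)" "b \<in> B" "j = h + b"
      by (auto elim: set_plus_elim)
    then have "g + h \<in> int_vec.span (set us)" "b \<in> B" "g + j = (g + h) + b"
      using assms(2) by (auto simp: int_vec.span_add algebra_simps)
    then show "g + j \<in> int_vec.span (set us) + B" by (metis set_plus_intro)
  qed
  then show ?thesis
    using assms(1) unfolding approx_row_def by (intro avoiding_shift)
qed

lemma SA_apply: "SA us x c = (if c \<in> int_pow (length us) then x (lincomb us c) else None)"
  by (simp add: SA_def restrict_map_def)

section \<open>Speed of convergence\<close>

text \<open>The admissibility condition in \<^const>\<open>speed\<close> and \<^const>\<open>speed_row\<close>, with the position of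
  an occurrence moved to the origin.\<close>

lemma language_SA_iff:
  assumes eqv: "\<And>x g. x \<in> X \<union> R \<Longrightarrow> \<tau> (shift g x) = shift g (\<tau> x)"
    and X: "\<And>x g. x \<in> X \<Longrightarrow> shift g x \<in> X"
    and R: "\<And>x g. x \<in> R \<Longrightarrow> g \<in> int_vec.span (set us) \<Longrightarrow> shift g x \<in> R"
    and B: "\<And>x g. x \<in> R \<Longrightarrow> g \<in> int_vec.span (set us) \<Longrightarrow> \<tau> x g \<in> Some ` B"
  shows "(\<forall>u\<in>configs (cube k (length us)) B.
        u \<notin> language (SA us ` \<tau> ` X) \<longrightarrow> u \<notin> language (SA us ` \<tau> ` R)) \<longleftrightarrow>
      (\<forall>x\<in>R. \<exists>z\<in>X. \<forall>c\<in>cube k (length us). \<tau> z (lincomb us c) = \<tau> x (lincomb us c))"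
    (is "?L \<longleftrightarrow> ?R")
proof
  assume L: ?L
  show ?R
  proof
    fix x assume x: "x \<in> R"
    define u where "u = SA us (\<tau> x) |` cube k (length us)"
    have u: "u c = \<tau> x (lincomb us c)" if "c \<in> cube k (length us)" for c
      using that cube_subset_int_pow by (auto simp: u_def SA_apply)
    have uc: "u \<in> configs (cube k (length us)) B"
      using u B[OF x lincomb_in_span] by (auto simp: mem_configs_iff) (simp add: u_def)
    then have dom_u: "dom u = cube k (length us)" by (simp add: configs_def)
    show "\<exists>z\<in>X. \<forall>c\<in>cube k (length us). \<tau> z (lincomb us c) = \<tau> x (lincomb us c)"
    proof -
      have "u \<subseteq>\<^sub>m shift 0 (SA us (\<tau> x))" by (auto simp: u_def map_le_def)
      then have "appears u (SA us (\<tau> x))" unfolding appears_def by blast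
      then have "u \<in> language (SA us ` \<tau> ` R)" using x finite_cube dom_u by (auto simp: language_def)
      then have "u \<in> language (SA us ` \<tau> ` X)" using L uc by blast
      then obtain z i where z: "z \<in> X"
        and i: "\<And>c. c \<in> cube k (length us) \<Longrightarrow> SA us (\<tau> z) (i + c) = u c"
        by (auto simp: language_def appears_iff dom_u)
      have "\<tau> (shift (lincomb us i) z) (lincomb us c) = \<tau> x (lincomb us c)"
        if c: "c \<in> cube k (length us)" for c
      proof -
        \<comment> \<open>The position \<open>i\<close> is an arbitrary function on the naturals. A
          defined value forces \<open>i + c\<close> into \<open>int_pow\<close>, which is what
          unfolding \<open>SA\<close> requires.\<close>
        have "SA us (\<tau> z) (i + c) \<noteq> None"
          using i[OF c] uc c by (auto dest: configsD)
        then have "SA us (\<tau> z) (i + c) = \<tau> z (lincomb us i + lincomb us c)"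
          by (auto simp: SA_apply lincomb_add split: if_splits)
        then show ?thesis using i[OF c] u[OF c] z eqv by (simp add: shift_def)
      qed
      then show ?thesis using X[OF z] by blast
    qed
  qed
next
  assume r: ?R
  show ?L
  proof (intro ballI impI notI, elim notE)
    fix u assume uc: "u \<in> configs (cube k (length us)) B" and "u \<in> language (SA us ` \<tau> ` R)"
    then obtain x i where fin: "finite (dom u)" and x: "x \<in> R"
      and i: "\<And>c. c \<in> dom u \<Longrightarrow> SA us (\<tau> x) (i + c) = u c"
      by (auto simp: language_def appears_iff)
    have dom_u: "dom u = cube k (length us)" using uc by (simp add: configs_def)
    from r R[OF x lincomb_in_span] obtain z where z: "z \<in> X"
      "\<And>c. c \<in> cube k (length us) \<Longrightarrow>
        \<tau> z (lincomb us c) = \<tau> (shift (lincomb us i) x) (lincomb us c)"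
      by blast
    have "SA us (\<tau> z) (0 + c) = u c" if c: "c \<in> dom u" for c
    proof -
      have "SA us (\<tau> x) (i + c) \<noteq> None" using i[OF c] c by auto
      then have "SA us (\<tau> x) (i + c) = \<tau> x (lincomb us i + lincomb us c)"
        by (auto simp: SA_apply lincomb_add split: if_splits)
      moreover have "SA us (\<tau> z) c = \<tau> z (lincomb us c)"
        using c dom_u cube_subset_int_pow by (auto simp: SA_apply)
      ultimately show ?thesis
        using i[OF c] z(2) c dom_u eqv x by (simp add: shift_def)
    qed
    then have "appears u (SA us (\<tau> z))" unfolding appears_iff by blast
    then show "u \<in> language (SA us ` \<tau> ` X)" using fin z(1) by (auto simp: language_def)
  qed
qed

text \<open>The admissibility condition freed from languages and block alphabets: equality of block
  symbols over the cube becomes pointwise equality on the cube thickened by \<open>box vs t\<close>.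
  The row size is \<open>t\<close>, and \<open>t = 0\<close> gives the condition in
  \<open>speed\<close>.\<close>

definition row_extends ::
    "nat \<Rightarrow> 'a set \<Rightarrow> (int ^ 'd::finite \<rightharpoonup> 'a) set \<Rightarrow> (int ^ 'd) list \<Rightarrow> (int ^ 'd) list
     \<Rightarrow> nat \<Rightarrow> nat \<Rightarrow> bool" where
  "row_extends t A F us vs k n \<longleftrightarrow>
     (\<forall>x\<in>approx_row A F us vs n. \<exists>z\<in>sft A F.
        \<forall>c\<in>cube k (length us). \<forall>b\<in>box vs t. z (lincomb us c + b) = x (lincomb us c + b))"

lemma approx_rowD:
  "x \<in> approx_row A F us vs n \<Longrightarrow> g \<in> int_vec.span (set us) \<Longrightarrow> b \<in> box vs n \<Longrightarrow> x (g + b) \<in> Some ` A"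
  unfolding approx_row_def avoiding_def by (blast intro: configsD set_plus_intro)

lemma speed_eq: "speed A F us vs k = (LEAST n. n \<ge> 1 \<and> row_extends 0 A F us vs k n)"
proof -
  have "(\<forall>u \<in> configs (cube k (length us)) A.
        u \<notin> language (SA us ` (\<lambda>x. x) ` sft A F) \<longrightarrow>
        u \<notin> language (SA us ` (\<lambda>x. x) ` approx_row A F us vs n)) \<longleftrightarrow>
      row_extends 0 A F us vs k n" for n
    using approx_rowD[OF _ _ zero_mem_box, of _ A F us vs n]
    by (subst language_SA_iff) (simp_all add: row_extends_def box_0 sft_shift approx_row_shift)
  then show ?thesis by (simp add: speed_def)
qed

lemma theta_apply:
  "(\<And>b. b \<in> box vs r \<Longrightarrow> x (g + b) \<noteq> None) \<Longrightarrow> theta vs r x g = Some (shift g x |` box vs r)"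
  by (simp add: theta_def domIff)

lemma theta_shift: "theta vs r (shift g x) = shift g (theta vs r x)"
  by (auto simp: theta_def shift_def fun_eq_iff add.assoc domIff)

lemma theta_eq_iff:
  assumes "\<And>b. b \<in> box vs r \<Longrightarrow> x (g + b) \<noteq> None" "\<And>b. b \<in> box vs r \<Longrightarrow> z (g + b) \<noteq> None"
  shows "theta vs r z g = theta vs r x g \<longleftrightarrow> (\<forall>b\<in>box vs r. z (g + b) = x (g + b))"
proof -
  have "shift g z |` box vs r = shift g x |` box vs r \<longleftrightarrow>
      (\<forall>b\<in>box vs r. z (g + b) = x (g + b))"
    by (auto simp: fun_eq_iff restrict_map_def shift_def)
  then show ?thesis using theta_apply[of vs r x g] theta_apply[of vs r z g] assms by simp
qed

text \<open>For \<open>n \<ge> r\<close> a row contains the box of radius \<open>r\<close> around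
  every point of the first lattice, so \<open>theta\<close> is defined there and compares blocks
  letter by letter. Smaller \<open>n\<close> are excluded on both sides.\<close>

lemma speed_row_eq:
  "speed_row r A F us vs k = (LEAST n. n \<ge> max 1 r \<and> row_extends r A F us vs k n)"
proof -
  have "(\<forall>u \<in> configs (cube k (length us)) (configs (box vs r) A).
        u \<notin> language (SA us ` theta vs r ` sft A F) \<longrightarrow>
        u \<notin> language (SA us ` theta vs r ` approx_row A F us vs n)) \<longleftrightarrow>
      row_extends r A F us vs k n" if "r \<le> n" for n
  proof -
    have R: "x (g + b) \<in> Some ` A"
      if "x \<in> approx_row A F us vs n" "g \<in> int_vec.span (set us)" "b \<in> box vs r" for x g b
      using approx_rowD that box_mono[OF \<open>r \<le> n\<close>] by blast
    have B: "theta vs r x g \<in> Some ` configs (box vs r) A"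
      if "x \<in> approx_row A F us vs n" "g \<in> int_vec.span (set us)" for x g
    proof -
      have "theta vs r x g = Some (shift g x |` box vs r)"
        using R[OF that] by (intro theta_apply) blast
      moreover have "shift g x |` box vs r \<in> configs (box vs r) A"
        using R[OF that] by (simp add: mem_configs_iff shift_def)
      ultimately show ?thesis by blast
    qed
    have "theta vs r z (lincomb us c) = theta vs r x (lincomb us c) \<longleftrightarrow>
        (\<forall>b\<in>box vs r. z (lincomb us c + b) = x (lincomb us c + b))"
      if x: "x \<in> approx_row A F us vs n" and z: "z \<in> sft A F" for x z c
      using R[OF x lincomb_in_span] sftD[OF z] by (intro theta_eq_iff) blast+
    then show ?thesis
      by (subst language_SA_iff)
        (simp_all add: row_extends_def sft_shift approx_row_shift theta_shift B)
  qed
  then have "(n \<ge> max 1 r \<and> (\<forall>u \<in> configs (cube k (length us)) (configs (box vs r) A).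
        u \<notin> language (SA us ` theta vs r ` sft A F) \<longrightarrow>
        u \<notin> language (SA us ` theta vs r ` approx_row A F us vs n))) \<longleftrightarrow>
      (n \<ge> max 1 r \<and> row_extends r A F us vs k n)" for n
    by auto
  then show ?thesis unfolding speed_row_def by presburger
qed

lemma speed_eq_speed_row_0: "speed A F us vs k = speed_row 0 A F us vs k"
  by (simp add: speed_eq speed_row_eq)

text \<open>Ensures that the least values are attained: local admissibility is applied to the finite
  set of positions compared by \<open>row_extends\<close>, and the resulting window fits into every
  sufficiently thick row. The lower bound \<open>m\<close> accommodates the condition
  \<open>n \<ge> max 1 r\<close>.\<close>

lemma row_extends_exists:
  assumes A: "finite A" and F: "F \<subseteq> patterns A"
    and span: "int_vec.span (set us) + int_vec.span (set vs) = UNIV"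
  shows "\<exists>n\<ge>m. row_extends t A F us vs k n"
proof -
  let ?S = "(\<lambda>(c, b). lincomb us c + b) ` (cube k (length us) \<times> box vs t)"
  have "finite ?S" using finite_cube finite_box by blast
  then obtain W where W: "finite W"
    "\<And>D x. W \<subseteq> D \<Longrightarrow> x \<in> avoiding D A F \<Longrightarrow> \<exists>z\<in>sft A F. \<forall>s\<in>?S. z s = x s"
    using locally_admissible_extends[OF A F] by metis
  obtain N where N: "W \<subseteq> box us N + box vs N"
    using finite_subset_box_sum[OF W(1) span] .
  define n where "n = max m N"
  have "box us N + box vs N \<subseteq> int_vec.span (set us) + box vs n"
    by (intro set_plus_mono2 box_subset_span box_mono) (simp add: n_def)
  with N have WG: "W \<subseteq> int_vec.span (set us) + box vs n" by (rule order_trans)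
  have "row_extends t A F us vs k n"
    unfolding row_extends_def approx_row_def
  proof
    fix x assume "x \<in> avoiding (int_vec.span (set us) + box vs n) A F"
    then obtain z where "z \<in> sft A F" "\<forall>s\<in>?S. z s = x s" using W(2)[OF WG] by blast
    then show "\<exists>z\<in>sft A F. \<forall>c\<in>cube k (length us). \<forall>b\<in>box vs t.
        z (lincomb us c + b) = x (lincomb us c + b)"
      by (intro bexI[of _ z]) auto
  qed
  then show ?thesis unfolding n_def by (intro exI[of _ "max m N"]) simp
qed

text \<open>A row of half-width \<open>n + M\<close> is mapped to a row of half-width
  \<open>n\<close> avoiding \<open>F'\<close>. An extension \<open>y'\<close> of the latter on the
  region enlarged by \<open>V\<close> is brought back by \<phi>. The threshold
  \<open>M\<^sub>0\<close> depends on neither \<open>t\<close>, \<open>k\<close> nor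
  \<open>n\<close>, and every larger \<open>M\<close> works, so that one constant can later serve
  both directions.\<close>

lemma row_extends_transfer:
  fixes F :: "(int ^ 'd::finite \<rightharpoonup> 'a) set" and F' :: "(int ^ 'd \<rightharpoonup> 'b) set"
  assumes A: "finite A" "F \<subseteq> patterns A" and F': "finite F'" "F' \<subseteq> patterns A'"
    and span: "int_vec.span (set us) + int_vec.span (set vs) = UNIV"
    and \<psi>: "\<psi> \<in> sft A F \<rightarrow> sft A' F'"
    and \<phi>: "\<phi> \<in> sft A' F' \<rightarrow> sft A F"
    and inv: "\<forall>x\<in>sft A F. \<phi> (\<psi> x) = x"
    and U: "has_neighborhood \<psi> (sft A F) U" and V: "has_neighborhood \<phi> (sft A' F') V"
    and Vb: "V \<subseteq> box us r + box vs s"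
  shows "\<exists>M\<^sub>0. \<forall>M\<ge>M\<^sub>0. \<forall>t k n. t + s \<le> n \<longrightarrow> row_extends (t + s) A' F' us vs (k + 2 * r) n \<longrightarrow>
    row_extends t A F us vs k (n + M)"
proof -
  let ?G = "int_vec.span (set us)"
  obtain W where W: "finite W"
    "\<And>D D' x. D' \<noteq> {} \<Longrightarrow> (\<And>i w. i \<in> D' \<Longrightarrow> w \<in> W \<Longrightarrow> i + w \<in> D) \<Longrightarrow> x \<in> avoiding D A F \<Longrightarrow>
      \<exists>y\<in>avoiding D' A' F'. \<forall>y'\<in>sft A' F'. \<forall>i\<in>D'. \<forall>j.
        (\<forall>v\<in>V. i + v \<in> D' \<and> y' (j + v) = y (i + v)) \<longrightarrow> \<phi> y' j = x i"
    using local_rule_transfer[OF A F' \<psi> inv U V] by metis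
  obtain M\<^sub>0 where M\<^sub>0: "W \<subseteq> box us M\<^sub>0 + box vs M\<^sub>0"
    using finite_subset_box_sum[OF W(1) span] .
  \<comment> \<open>Components along the first lattice are absorbed, since rows are invariant under
    it; only the components along \<open>vs\<close> consume width.\<close>
  have row_add: "(g + b) + (h + e) \<in> ?G + box vs (n + m)"
    if "g \<in> ?G" "h \<in> ?G" "b \<in> box vs n" "e \<in> box vs m" for g h b e n m
  proof -
    have "(g + h) + (b + e) \<in> ?G + box vs (n + m)"
      using that by (intro set_plus_intro int_vec.span_add box_add)
    then show ?thesis by (simp add: algebra_simps)
  qed
  have "row_extends t A F us vs k (n + M)"
    if M: "M\<^sub>0 \<le> M" and n: "t + s \<le> n" and ext: "row_extends (t + s) A' F' us vs (k + 2 * r) n"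
    for M t k n
    unfolding row_extends_def
  proof
    fix x assume x: "x \<in> approx_row A F us vs (n + M)"
    let ?D' = "?G + box vs n"
    have "0 + 0 \<in> ?D'" by (intro set_plus_intro int_vec.span_zero zero_mem_box)
    then have "?D' \<noteq> {}" by blast
    moreover have "i + w \<in> ?G + box vs (n + M)" if iw: "i \<in> ?D'" "w \<in> W" for i w
    proof -
      obtain g b where "i = g + b" "g \<in> ?G" "b \<in> box vs n" using iw(1) by (rule set_plus_elim)
      moreover have "w \<in> box us M\<^sub>0 + box vs M\<^sub>0" using iw(2) M\<^sub>0 by blast
      then obtain h e where "w = h + e" "h \<in> box us M\<^sub>0" "e \<in> box vs M\<^sub>0" by (rule set_plus_elim)
      then have "w = h + e" "h \<in> ?G" "e \<in> box vs M"
        using box_subset_span box_mono[OF M] by blast+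
      ultimately show ?thesis using row_add by simp
    qed
    ultimately obtain y where y: "y \<in> approx_row A' F' us vs n"
      and yx: "\<And>y' i j. y' \<in> sft A' F' \<Longrightarrow> i \<in> ?D' \<Longrightarrow>
        (\<And>v. v \<in> V \<Longrightarrow> i + v \<in> ?D' \<and> y' (j + v) = y (i + v)) \<Longrightarrow> \<phi> y' j = x i"
      using W(2)[of ?D' "?G + box vs (n + M)" x] x unfolding approx_row_def by blast
    \<comment> \<open>The cube enlarged by \<open>r\<close> on each side has its corner at
      \<open>-r\<close>; translating the row by \<open>- d\<close> moves that corner to the origin,
      where \<open>row_extends\<close> expects it.\<close>
    define d where "d = lincomb us (\<lambda>_. int r)"
    have "shift (- d) y \<in> approx_row A' F' us vs n"
      unfolding d_def by (intro approx_row_shift[OF y] int_vec.span_neg lincomb_in_span)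
    from bspec[OF ext[unfolded row_extends_def] this]
    obtain y' where y': "y' \<in> sft A' F'"
      "\<forall>c\<in>cube (k + 2 * r) (length us). \<forall>b\<in>box vs (t + s).
        y' (lincomb us c + b) = shift (- d) y (lincomb us c + b)"
      by (elim bexE)
    have "\<phi> y' (d + (lincomb us c + b)) = x (lincomb us c + b)"
      if c: "c \<in> cube k (length us)" and b: "b \<in> box vs t" for c b
    proof (rule yx[OF y'(1)])
      show "lincomb us c + b \<in> ?D'"
        using b n box_mono[of t n vs] by (intro set_plus_intro lincomb_in_span) auto
    next
      fix v assume "v \<in> V"
      then have "v \<in> box us r + box vs s" using Vb by blast
      then obtain g e where v: "v = g + e" "g \<in> box us r" "e \<in> box vs s" by (rule set_plus_elim)
      have "g \<in> ?G" using v(2) box_subset_span by blast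
      then have "(lincomb us c + b) + (g + e) \<in> ?G + box vs (t + s)"
        using row_add[OF lincomb_in_span] b v(3) by blast
      then have "lincomb us c + b + v \<in> ?D'"
        using v(1) set_plus_mono2[OF subset_refl box_mono[OF n], of ?G] by blast
      moreover obtain c' where c': "c' \<in> cube (k + 2 * r) (length us)"
        "lincomb us c' = lincomb us c + d + g"
        unfolding d_def using cube_add_box[OF c v(2)] .
      have "y' (lincomb us c' + (b + e)) = shift (- d) y (lincomb us c' + (b + e))"
        using y'(2) c'(1) box_add[OF b v(3)] by blast
      then have "y' (d + (lincomb us c + b) + v) = y (lincomb us c + b + v)"
        by (simp add: shift_def c'(2) v(1) algebra_simps)
      ultimately show "lincomb us c + b + v \<in> ?D' \<and>
          y' (d + (lincomb us c + b) + v) = y (lincomb us c + b + v)" ..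
    qed
    then show "\<exists>z\<in>sft A F. \<forall>c\<in>cube k (length us). \<forall>b\<in>box vs t.
        z (lincomb us c + b) = x (lincomb us c + b)"
      \<comment> \<open>Shifting \<open>\<phi> y'\<close> by \<open>d\<close> undoes the
        recentring.\<close>
      using sft_shift[OF funcset_mem[OF \<phi> y'(1)], of d] by (intro bexI[of _ "shift d (\<phi> y')"]) (auto simp: shift_def)
  qed
  then show ?thesis by blast
qed

text \<open>The speed \<open>n\<close> on the right is itself admissible, hence \<open>n + M\<close>
  is admissible on the left. Its lower bound \<open>max 1 (t + s)\<close> supplies both
  \<open>t + s \<le> n\<close> and the condition \<open>n + M \<ge> max 1 t\<close>.\<close>

lemma speed_row_transfer:
  fixes F :: "(int ^ 'd::finite \<rightharpoonup> 'a) set" and F' :: "(int ^ 'd \<rightharpoonup> 'b) set"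
  assumes A: "finite A" "F \<subseteq> patterns A" and F': "finite A'" "finite F'" "F' \<subseteq> patterns A'"
    and span: "int_vec.span (set us) + int_vec.span (set vs) = UNIV"
    and \<psi>: "\<psi> \<in> sft A F \<rightarrow> sft A' F'"
    and \<phi>: "\<phi> \<in> sft A' F' \<rightarrow> sft A F"
    and inv: "\<forall>x\<in>sft A F. \<phi> (\<psi> x) = x"
    and U: "has_neighborhood \<psi> (sft A F) U" and V: "has_neighborhood \<phi> (sft A' F') V"
    and Vb: "V \<subseteq> box us r + box vs s"
  shows "\<exists>M\<^sub>0. \<forall>M\<ge>M\<^sub>0. \<forall>t k.
    speed_row t A F us vs k \<le> speed_row (t + s) A' F' us vs (k + 2 * r) + M"
proof -
  obtain M\<^sub>0 where M\<^sub>0: "\<forall>M\<ge>M\<^sub>0. \<forall>t k n. t + s \<le> n \<longrightarrow>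
      row_extends (t + s) A' F' us vs (k + 2 * r) n \<longrightarrow> row_extends t A F us vs k (n + M)"
    using row_extends_transfer[OF A F'(2,3) span \<psi> \<phi> inv U V Vb] by (elim exE)
  have "speed_row t A F us vs k \<le> speed_row (t + s) A' F' us vs (k + 2 * r) + M"
    if M: "M\<^sub>0 \<le> M" for M t k
  proof -
    define n where "n = speed_row (t + s) A' F' us vs (k + 2 * r)"
    have "\<exists>n. n \<ge> max 1 (t + s) \<and> row_extends (t + s) A' F' us vs (k + 2 * r) n"
      using row_extends_exists[OF F'(1,3) span] by blast
    then have n: "n \<ge> max 1 (t + s) \<and> row_extends (t + s) A' F' us vs (k + 2 * r) n"
      unfolding n_def speed_row_eq by (rule LeastI_ex)
    then have "row_extends t A F us vs k (n + M)" using M\<^sub>0 M by simp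
    then have "speed_row t A F us vs k \<le> n + M"
      unfolding speed_row_eq using n by (intro Least_le) auto
    then show ?thesis by (simp add: n_def)
  qed
  then show ?thesis by blast
qed

theorem corollary2p4:
  fixes G H :: "(int ^ 'd::finite) set"
    and us vs :: "(int ^ 'd) list"
    and A :: "'a set" and A' :: "'b set"
    and F :: "(int ^ 'd \<rightharpoonup> 'a) set" and F' :: "(int ^ 'd \<rightharpoonup> 'b) set"
  assumes "int_vec.subspace G" and "int_vec.subspace H"
    and "G \<inter> H = {0}" and "G + H = UNIV"
    and "lattice_basis us G" and "lattice_basis vs H"
    and "finite A" and "finite A'"
    and "finite F" and "F \<subseteq> patterns A"
    and "finite F'" and "F' \<subseteq> patterns A'"
    and "conjugate (sft A F) (sft A' F')"
  shows "\<exists>r r' M :: nat.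
    ((\<exists>\<psi>. conjugacy_within G \<psi> (sft A F) (sft A' F')) \<longrightarrow> r' = 0) \<and>
    (\<forall>k.
      speed A F us vs k \<le> speed_row r' A' F' us vs (k + 2 * r) + M \<and>
      speed_row r' A' F' us vs (k + 2 * r) + M
        \<le> speed_row (2 * r') A F us vs (k + 4 * r) + 2 * M)"
proof -
  let ?X = "sft A F" and ?Y = "sft A' F'"
  have G: "int_vec.span (set us) = G" and "int_vec.span (set vs) = H"
    using assms(5,6) by (auto simp: lattice_basis_def)
  then have span: "int_vec.span (set us) + int_vec.span (set vs) = UNIV" using assms(4) by simp
  \<comment> \<open>The conjugacy is chosen after the case distinction: if one has neighborhoods
    inside \<open>G\<close> in both directions, it is the one used, and
    \<open>box vs 0 = {0}\<close> gives \<open>r' = 0\<close>.\<close>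
  have "\<exists>\<psi> U V r r'. conjugacy \<psi> ?X ?Y \<and> has_neighborhood \<psi> ?X U \<and>
      has_neighborhood (inv_into ?X \<psi>) ?Y V \<and> U \<union> V \<subseteq> box us r + box vs r' \<and>
      ((\<exists>\<psi>. conjugacy_within G \<psi> ?X ?Y) \<longrightarrow> r' = 0)"
  proof (cases "\<exists>\<psi>. conjugacy_within G \<psi> ?X ?Y")
    case True
    then obtain \<psi> U V where \<psi>: "conjugacy \<psi> ?X ?Y" "has_neighborhood \<psi> ?X U"
        "has_neighborhood (inv_into ?X \<psi>) ?Y V" and "U \<union> V \<subseteq> G"
      unfolding conjugacy_within_def by blast
    then have "finite (U \<union> V)" "U \<union> V \<subseteq> int_vec.span (set us)"
      using G by (auto simp: has_neighborhood_def)
    then obtain r where "U \<union> V \<subseteq> box us r" by (rule finite_subset_box)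
    then have "U \<union> V \<subseteq> box us r + box vs 0" by (simp add: box_0 set_plus_def)
    then show ?thesis using \<psi> by blast
  next
    case False
    obtain \<psi> where \<psi>: "conjugacy \<psi> ?X ?Y" using assms(13) by (auto simp: conjugate_def)
    then obtain U where U: "has_neighborhood \<psi> ?X U"
      using morphism_has_neighborhood[OF assms(7,10)] unfolding conjugacy_def by blast
    obtain V where V: "has_neighborhood (inv_into ?X \<psi>) ?Y V"
      using morphism_has_neighborhood[OF assms(8,12) conjugacy_inverse[OF assms(7,10) \<psi>]] by blast
    have "finite (U \<union> V)" using U V by (simp add: has_neighborhood_def)
    then obtain r where "U \<union> V \<subseteq> box us r + box vs r"
      by (rule finite_subset_box_sum[OF _ span])
    then show ?thesis using False \<psi> U V by blast
  qed
  then obtain \<psi> U V r r' where c: "conjugacy \<psi> ?X ?Y" and U: "has_neighborhood \<psi> ?X U"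
    and V: "has_neighborhood (inv_into ?X \<psi>) ?Y V"
    and UV: "U \<subseteq> box us r + box vs r'" "V \<subseteq> box us r + box vs r'"
    and r': "(\<exists>\<psi>. conjugacy_within G \<psi> ?X ?Y) \<longrightarrow> r' = 0"
    unfolding Un_subset_iff by (elim exE conjE)
  have bij: "bij_betw \<psi> ?X ?Y" using c by (simp add: conjugacy_def)
  let ?\<phi> = "inv_into ?X \<psi>"
  have \<psi>: "\<psi> \<in> ?X \<rightarrow> ?Y" and \<phi>: "?\<phi> \<in> ?Y \<rightarrow> ?X"
    using bij bij_betw_inv_into[OF bij] by (auto simp: bij_betw_def)
  have inv: "\<forall>x\<in>?X. ?\<phi> (\<psi> x) = x" "\<forall>y\<in>?Y. \<psi> (?\<phi> y) = y"
    using bij by (auto simp: bij_betw_def f_inv_into_f)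
  \<comment> \<open>The same radii bound both neighborhoods. The first bound is used with
    \<open>t = 0\<close>, the second with \<open>t = r'\<close> and \<open>k + 2 * r\<close> in
    place of \<open>k\<close>; composing them doubles the radii.\<close>
  obtain M1 where M1: "\<forall>M\<ge>M1. \<forall>t k.
      speed_row t A F us vs k \<le> speed_row (t + r') A' F' us vs (k + 2 * r) + M"
    using speed_row_transfer[OF assms(7,10,8,11,12) span \<psi> \<phi> inv(1) U V UV(2)] by (elim exE)
  obtain M2 where M2: "\<forall>M\<ge>M2. \<forall>t k.
      speed_row t A' F' us vs k \<le> speed_row (t + r') A F us vs (k + 2 * r) + M"
    using speed_row_transfer[OF assms(8,12,7,9,10) span \<phi> \<psi> inv(2) V U UV(1)] by (elim exE)
  define M where "M = max M1 M2"
  have "speed A F us vs k \<le> speed_row r' A' F' us vs (k + 2 * r) + M" for k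
    using M1[rule_format, of M 0 k] by (simp add: speed_eq_speed_row_0 M_def)
  moreover have "speed_row r' A' F' us vs (k + 2 * r) + M
      \<le> speed_row (2 * r') A F us vs (k + 4 * r) + 2 * M" for k
  proof -
    have "r' + r' = 2 * r'" "k + 2 * r + 2 * r = k + 4 * r" by simp_all
    note M2[rule_format, of M r' "k + 2 * r", unfolded this]
    then show ?thesis by (simp add: M_def)
  qed
  ultimately show ?thesis using r' by blast
qed

end
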